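(* Let $(X,S)$ be an asymmetric rank $3$ association scheme, and let $T_x$ be its complex Terwilliger algebra with respect to a fixed vertex $x\in X$. Then $T_x$ is thin, i.e. every irreducible $T_x$-module $V$ satisfies $\dim E_i^*V\le 1$ for every dual idempotent $E_i^*$ with respect to $x$.
   Context: An asymmetric rank $3$ association scheme on $X=\{1,\dots,n\}$ has adjacency matrices $A_0=I_n$, $A_1$, $A_1^{\top}$ with $A_1\ne A_1^{\top}$ and $I_n+A_1+A_1^{\top}=J_n$ (all-ones matrix); $A_1$ is the adjacency matrix of a doubly regular tournament, $n=4u+3$. For a vertex $x$, the dual idempotents $E_0^*,E_1^*,E_2^*$ are the diagonal $01$-matrices with $(E_i^* )_{yy}=1$ iff $(A_i)_{xy}=1$ (where $A_2=A_1^{\top}$). The Terwilliger algebra $T_x$ is the subalgebra of $M_n(\mathbb{C})$ generated by $A_0,A_1,A_1^{\top},E_0^*,E_1^*,E_2^*$. $T_x$ is called thin if all its irreducible modules are thin. *)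

theory Defs
  imports "HOL-Analysis.Analysis" "HOL-Library.Disjoint_Sets"
begin

text \<open>
  The point set \<open>X\<close> is the universe of a finite type, and a scheme is its set \<open>S\<close> of basic
  relations. Commutativity is not required; it is automatic in rank 3.
\<close>

definition association_scheme :: "('x::finite) rel set \<Rightarrow> bool" where
  "association_scheme S \<longleftrightarrow>
     partition_on UNIV S \<and> Id \<in> S \<and> (\<forall>s\<in>S. s\<inverse> \<in> S) \<and>
     (\<forall>p\<in>S. \<forall>q\<in>S. \<forall>r\<in>S. \<exists>c. \<forall>(a, b)\<in>r. card {z. (a, z) \<in> p \<and> (z, b) \<in> q} = c)"

definition scheme_rank :: "('x::finite) rel set \<Rightarrow> nat" where
  "scheme_rank S = card S"

text \<open>
  In rank 3 a single nonsymmetric relation \<open>s\<close> forces \<open>S = {Id, s, s\<inverse>}\<close>, so this agrees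
  with requiring every relation other than \<open>Id\<close> to be nonsymmetric.
\<close>

definition asymmetric :: "('x::finite) rel set \<Rightarrow> bool" where
  "asymmetric S \<longleftrightarrow> (\<exists>s\<in>S. s\<inverse> \<noteq> s)"

definition adjacency :: "('x::finite) rel \<Rightarrow> complex^'x^'x" where
  "adjacency s = (\<chi> y z. if (y, z) \<in> s then 1 else 0)"

definition dual_idempotent :: "'x::finite \<Rightarrow> 'x rel \<Rightarrow> complex^'x^'x" where
  "dual_idempotent x s = (\<chi> y z. if y = z \<and> (x, y) \<in> s then 1 else 0)"

text \<open>The vector scaling \<open>*s\<close> of a matrix would multiply by row vectors, hence a separate constant.\<close>

definition mat_scale :: "complex \<Rightarrow> complex^'x^'x \<Rightarrow> complex^'x^'x" where
  "mat_scale c M = (\<chi> y z. c * M $ y $ z)"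

definition subalgebra :: "(complex^'x^'x) set \<Rightarrow> bool" where
  "subalgebra T \<longleftrightarrow>
     mat 1 \<in> T \<and> (\<forall>M\<in>T. \<forall>N\<in>T. M + N \<in> T) \<and>
     (\<forall>c. \<forall>M\<in>T. mat_scale c M \<in> T) \<and> (\<forall>M\<in>T. \<forall>N\<in>T. M ** N \<in> T)"

definition terwilliger_algebra :: "('x::finite) rel set \<Rightarrow> 'x \<Rightarrow> (complex^'x^'x) set" where
  "terwilliger_algebra S x = subalgebra hull (adjacency ` S \<union> dual_idempotent x ` S)"

text \<open>
  A module over a matrix algebra \<open>T\<close>: a complex vector space \<open>V\<close>, given as a subspace of an
  ambient vector space, with a unital action of \<open>T\<close>. Both abstract modules (take \<open>V = UNIV\<close>) and
  \<open>T\<close>-invariant subspaces \<open>V\<close> of the standard module (take \<open>act = (*v)\<close>) are instances.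
  Only the values of \<open>act\<close> on \<open>T\<close> and \<open>V\<close> matter.
\<close>

locale algebra_module = vector_space smul
  for smul :: "complex \<Rightarrow> 'v::ab_group_add \<Rightarrow> 'v" +
  fixes T :: "(complex^'x^'x) set"
    and act :: "complex^'x^'x \<Rightarrow> 'v \<Rightarrow> 'v"
    and V :: "'v set"
  assumes carrier_subspace: "subspace V"
    and act_closed: "M \<in> T \<Longrightarrow> v \<in> V \<Longrightarrow> act M v \<in> V"
    and act_add_right: "M \<in> T \<Longrightarrow> v \<in> V \<Longrightarrow> w \<in> V \<Longrightarrow> act M (v + w) = act M v + act M w"
    and act_scale_right: "M \<in> T \<Longrightarrow> v \<in> V \<Longrightarrow> act M (smul c v) = smul c (act M v)"
    and act_add_left: "M \<in> T \<Longrightarrow> N \<in> T \<Longrightarrow> v \<in> V \<Longrightarrow> act (M + N) v = act M v + act N v"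
    and act_scale_left: "M \<in> T \<Longrightarrow> v \<in> V \<Longrightarrow> act (mat_scale c M) v = smul c (act M v)"
    and act_mult: "M \<in> T \<Longrightarrow> N \<in> T \<Longrightarrow> v \<in> V \<Longrightarrow> act (M ** N) v = act M (act N v)"
    and act_one: "v \<in> V \<Longrightarrow> act (mat 1) v = v"
begin

definition submodule :: "'v set \<Rightarrow> bool" where
  "submodule W \<longleftrightarrow> subspace W \<and> W \<subseteq> V \<and> (\<forall>M\<in>T. \<forall>w\<in>W. act M w \<in> W)"

end

locale irreducible_module = algebra_module +
  assumes nonzero: "V \<noteq> {0}"
    and only_trivial_submodules: "submodule W \<Longrightarrow> W = {0} \<or> W = V"

text \<open>
  \<open>dim\<close> is \<open>0\<close> on infinite-dimensional sets, so a dimension bound also needs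
  finite-dimensionality. No finiteness of \<open>V\<close> itself is assumed.
\<close>

definition dim_at_most ::
    "(complex \<Rightarrow> 'v::ab_group_add \<Rightarrow> 'v) \<Rightarrow> 'v set \<Rightarrow> nat \<Rightarrow> bool" where
  "dim_at_most smul W d \<longleftrightarrow>
     (\<exists>B. finite B \<and> W \<subseteq> module.span smul B) \<and> vector_space.dim smul W \<le> d"

end

theory Submission
  imports Defs "HOL-Computational_Algebra.Fundamental_Theorem_Algebra"
begin

text \<open>
  An irreducible module \<open>V\<close> is cyclic, so if the corner algebra \<open>e T e\<close> of an idempotent \<open>e\<close> is
  commutative, an eigenvector in \<open>e V\<close> of an element of \<open>e T e\<close> forces that element to act as a
  scalar on \<open>e V\<close>, whence \<open>e V\<close> is at most one-dimensional. It remains to see that the corners are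
  commutative. For \<open>E\<^sub>0\<^sup>*\<close>, which has rank one, this is clear. For \<open>e = E\<^sub>1\<^sup>*\<close> the relation expressing
  \<open>A\<^sup>2\<close> through \<open>A\<close>, \<open>I\<close>, \<open>J\<close> turns a walk through the second neighbourhood into a combination of
  walks inside the first one and of all-ones blocks. Hence \<open>e T e\<close> lies in the double commutant of
  the two commuting matrices \<open>e A e\<close> and \<open>e J e\<close>.
\<close>

subsection \<open>Idempotents with commutative corner\<close>

text \<open>Linearity is demanded on \<open>E\<close> only: the module axioms constrain
  \<open>act M\<close> just on \<open>V\<close>, so it need not be linear on the whole type.\<close>

locale linear_on_subspace = vector_space scale
  for scale :: "'a::field \<Rightarrow> 'b::ab_group_add \<Rightarrow> 'b" +
  fixes E :: "'b set" and f :: "'b \<Rightarrow> 'b"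
  assumes sub: "subspace E"
    and closed: "v \<in> E \<Longrightarrow> f v \<in> E"
    and add: "v \<in> E \<Longrightarrow> w \<in> E \<Longrightarrow> f (v + w) = f v + f w"
    and scaled: "v \<in> E \<Longrightarrow> f (scale c v) = scale c (f v)"
begin

text \<open>This is p(f) v in Horner form, so that induction along \<open>pCons\<close> unfolds it
  directly.\<close>

definition poly_apply :: "'a poly \<Rightarrow> 'b \<Rightarrow> 'b" where
  "poly_apply p v = fold_coeffs (\<lambda>c w. scale c v + f w) p 0"

lemma map_zero: "f 0 = 0"
  using scaled[OF subspace_0[OF sub], of 0] by simp

lemma poly_apply_0 [simp]: "poly_apply 0 v = 0"
  by (simp add: poly_apply_def)

lemma poly_apply_pCons [simp]:
  "poly_apply (pCons c p) v = scale c v + f (poly_apply p v)"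
  \<comment> \<open>\<open>pCons 0 0\<close> collapses to \<open>0\<close> and is not seen by
    \<open>fold_coeffs\<close>; there the right-hand side vanishes because
    \<open>f 0 = 0\<close>.\<close>
  by (cases "p = 0 \<and> c = 0") (auto simp: poly_apply_def map_zero)

lemma poly_apply_closed: "v \<in> E \<Longrightarrow> poly_apply p v \<in> E"
  by (induction p) (auto intro: subspace_add[OF sub] subspace_scale[OF sub] subspace_0[OF sub] closed)

lemma poly_apply_add:
  assumes "v \<in> E"
  shows "poly_apply (p + q) v = poly_apply p v + poly_apply q v"
  by (induction p q rule: poly_induct2)
     (simp_all add: add poly_apply_closed[OF assms] scale_left_distrib)

lemma poly_apply_smult:
  assumes "v \<in> E"
  shows "poly_apply (smult c p) v = scale c (poly_apply p v)"
  by (induction p) (simp_all add: scaled poly_apply_closed[OF assms] scale_right_distrib)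

lemma poly_apply_monom:
  assumes "v \<in> E"
  shows "poly_apply (monom c n) v = scale c ((f ^^ n) v)"
proof -
  have "(f ^^ n) v \<in> E" for n by (induction n) (simp_all add: assms closed)
  then show ?thesis
    by (induction n) (simp_all add: monom_0 monom_Suc map_zero scaled)
qed

lemma poly_apply_sum:
  assumes "v \<in> E"
  shows "poly_apply (\<Sum>i\<in>I. p i) v = (\<Sum>i\<in>I. poly_apply (p i) v)"
  by (induction I rule: infinite_finite_induct) (simp_all add: poly_apply_add[OF assms])

lemma poly_apply_linear_factor:
  assumes "v \<in> E"
  shows "poly_apply ([:-c, 1:] * q) v = f (poly_apply q v) - scale c (poly_apply q v)"
proof -
  have "[:-c, 1:] * q = pCons 0 q + smult (-c) q" by simp
  then show ?thesis
    by (simp add: poly_apply_add[OF assms] poly_apply_smult[OF assms] del: smult_minus_left)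
qed

text \<open>A nonzero constant cannot annihilate \<open>v\<close>, so p has a root c and factors as
  (X - c) q. Either q, of smaller degree, already annihilates \<open>v\<close>, or q(f) v is an
  eigenvector for c.\<close>

lemma eigenvector_exists:
  assumes alg_closed: "\<And>p :: 'a poly. degree p > 0 \<Longrightarrow> \<exists>z. poly p z = 0"
    and v: "v \<in> E" "v \<noteq> 0" and p: "p \<noteq> 0" "poly_apply p v = 0"
  shows "\<exists>c w. w \<in> E \<and> w \<noteq> 0 \<and> f w = scale c w"
  using p
proof (induction "degree p" arbitrary: p rule: less_induct)
  case less
  have "degree p > 0"
  proof (rule ccontr)
    assume "\<not> degree p > 0"
    then obtain c where "p = [:c:]" by (auto elim: degree_eq_zeroE)
    then show False using less.prems v map_zero by simp
  qed
  then obtain c where "poly p c = 0" using alg_closed by blast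
  then obtain q where q: "p = [:-c, 1:] * q" by (auto simp: poly_eq_0_iff_dvd)
  then have "q \<noteq> 0" using less.prems by auto
  then have deg: "degree q < degree p"
    unfolding q by (subst degree_mult_eq) auto
  show ?case
  proof (cases "poly_apply q v = 0")
    case True
    then show ?thesis using less.hyps[OF deg \<open>q \<noteq> 0\<close>] by blast
  next
    case False
    have "f (poly_apply q v) = scale c (poly_apply q v)"
      using less.prems(2) unfolding q poly_apply_linear_factor[OF v(1)] by simp
    then show ?thesis using False poly_apply_closed[OF v(1)] by blast
  qed
qed

end

text \<open>One vector more than the dimension forces a relation. Coefficients belong to indices
  rather than to vectors, because the powers of a matrix may repeat; a repetition is itself a
  relation, with coefficients 1 and -1.\<close>

lemma dependent_sequence:
  fixes b :: "nat \<Rightarrow> 'a::euclidean_space"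
  obtains N u where "(\<Sum>i\<le>N. u i *\<^sub>R b i) = 0" "\<exists>i\<le>N. u i \<noteq> 0"
proof -
  define N where "N = DIM('a)"
  show ?thesis
  proof (cases "inj_on b {..N}")
    case True
    then have "card (b ` {..N}) > DIM('a)" by (simp add: card_image N_def)
    then have "dependent (b ` {..N})"
      using independent_bound[of "b ` {..N}"] by fastforce
    then obtain u where u: "\<exists>v\<in>b ` {..N}. u v \<noteq> 0" "(\<Sum>v\<in>b ` {..N}. u v *\<^sub>R v) = 0"
      by (auto simp: real_vector.dependent_finite)
    show ?thesis
      by (rule that[of "\<lambda>i. u (b i)" N]) (use u True in \<open>auto simp: sum.reindex\<close>)
  next
    case False
    then obtain i j where ij: "i \<le> N" "j \<le> N" "i \<noteq> j" "b i = b j" by (auto simp: inj_on_def)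
    define u :: "nat \<Rightarrow> real" where "u l = (if l = i then 1 else 0) - (if l = j then 1 else 0)" for l
    have "(\<Sum>l\<le>N. u l *\<^sub>R b l)
        = (\<Sum>l\<le>N. (if l = i then b l else 0) - (if l = j then b l else 0))"
      by (rule sum.cong) (auto simp: u_def)
    also have "\<dots> = 0" using ij by (simp add: sum_subtractf)
    finally show ?thesis by (rule that) (use ij in \<open>auto simp: u_def\<close>)
  qed
qed

section \<open>Cyclicity and one-dimensional corners of irreducible modules\<close>

context irreducible_module
begin

lemma act_zero_right: "M \<in> T \<Longrightarrow> act M 0 = 0"
  using act_scale_right[of M 0 0] subspace_0[OF carrier_subspace] by simp

text \<open>The orbit of \<open>v\<close> under \<open>T\<close> is a submodule; it contains
  \<open>v\<close> since the action is unital, so it is nonzero and fills \<open>V\<close>.\<close>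

lemma cyclic:
  assumes T: "subalgebra T" and v: "v \<in> V" "v \<noteq> 0" and w: "w \<in> V"
  shows "\<exists>M\<in>T. w = act M v"
proof -
  define W where "W = (\<lambda>M. act M v) ` T"
  have one: "mat 1 \<in> T" using T by (simp add: subalgebra_def)
  have "subspace W"
  proof (rule subspaceI)
    have "act (mat_scale 0 (mat 1)) v = 0"
      using act_scale_left[OF one v(1)] by simp
    then show "0 \<in> W" using T one unfolding W_def subalgebra_def by (metis image_eqI)
  qed (use T v in \<open>auto simp: W_def subalgebra_def act_add_left[symmetric] act_scale_left[symmetric]\<close>)
  then have "submodule W"
    unfolding submodule_def using T v
    by (auto simp: W_def subalgebra_def act_closed act_mult[symmetric])
  moreover have "v \<in> W" using one act_one[OF v(1)] by (force simp: W_def)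
  ultimately have "W = V" using only_trivial_submodules v by blast
  then show ?thesis using w by (auto simp: W_def)
qed

lemma act_power:
  assumes T: "subalgebra T" and M: "M \<in> T" and v: "v \<in> V"
  shows "((**) M ^^ n) (mat 1) \<in> T \<and> act (((**) M ^^ n) (mat 1)) v = (act M ^^ n) v"
  using T M v by (induction n) (auto simp: subalgebra_def act_one act_mult)

text \<open>\<open>V\<close> may a priori be infinite-dimensional, but the powers of
  \<open>M\<close> lie in a finite-dimensional space of matrices, and a relation between them passes
  through the action. Counting real dimension is enough: the real coefficients are read as complex
  ones.\<close>

lemma annihilating_poly:
  assumes T: "subalgebra T" and M: "M \<in> T" and E: "linear_on_subspace smul E (act M)"
    and v: "v \<in> E" "v \<in> V"
  shows "\<exists>p. p \<noteq> 0 \<and> linear_on_subspace.poly_apply smul (act M) p v = 0"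
proof -
  interpret E: linear_on_subspace smul E "act M" by (rule E)
  define b where "b n = ((**) M ^^ n) (mat 1)" for n
  obtain N u where u: "(\<Sum>i\<le>N. u i *\<^sub>R b i) = 0" and nz: "\<exists>i\<le>N. u i \<noteq> 0"
    by (rule dependent_sequence)
  have scaleR: "r *\<^sub>R L = mat_scale (complex_of_real r) L" for r L
    by (simp add: vec_eq_iff mat_scale_def scaleR_conv_of_real[where 'a = complex])
  define p where "p = (\<Sum>i\<le>N. monom (of_real (u i)) i :: complex poly)"
  have "coeff p i = of_real (u i)" if "i \<le> N" for i
    using that by (simp add: p_def coeff_sum)
  then have "p \<noteq> 0" using nz by (metis coeff_0 of_real_eq_0_iff)
  \<comment> \<open>Membership in \<open>T\<close> is carried through the induction because
    \<open>act\<close> is known to be additive in the matrix only on \<open>T\<close>.\<close>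
  have "(\<Sum>i\<in>I. u i *\<^sub>R b i) \<in> T \<and>
      act (\<Sum>i\<in>I. u i *\<^sub>R b i) v = (\<Sum>i\<in>I. smul (of_real (u i)) ((act M ^^ i) v))"
    if "finite I" for I
    using that
  proof (induction I rule: finite_induct)
    case empty
    have "mat 1 \<in> T" using T by (simp add: subalgebra_def)
    then have "mat_scale 0 (mat 1) \<in> T" "act (mat_scale 0 (mat 1)) v = 0"
      using T act_scale_left[of "mat 1" v 0] v by (simp_all add: subalgebra_def)
    moreover have "mat_scale 0 (mat 1) = (0 :: complex^'b^'b)"
      by (simp add: vec_eq_iff mat_scale_def)
    ultimately show ?case by simp
  next
    case (insert i I)
    have "b i \<in> T" "act (b i) v = (act M ^^ i) v"
      using act_power[OF T M v(2)] by (simp_all add: b_def)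
    then have "u i *\<^sub>R b i \<in> T"
      "act (u i *\<^sub>R b i) v = smul (of_real (u i)) ((act M ^^ i) v)"
      using T act_scale_left v by (auto simp: scaleR subalgebra_def)
    then show ?case
      using insert T v by (auto simp: act_add_left subalgebra_def)
  qed
  from this[of "{..N}"] have "E.poly_apply p v = act 0 v" "0 \<in> T"
    by (simp_all add: u p_def E.poly_apply_sum[OF v(1)] E.poly_apply_monom[OF v(1)])
  moreover from this have "act 0 v = 0"
    using act_add_left[of 0 0 v] v by simp
  ultimately show ?thesis using \<open>p \<noteq> 0\<close> by auto
qed

lemma dim_corner_le_1:
  assumes T: "subalgebra T" and e: "e \<in> T" "e ** e = e"
    and comm: "\<And>M N. M \<in> T \<Longrightarrow> N \<in> T \<Longrightarrow>
      (e ** M ** e) ** (e ** N ** e) = (e ** N ** e) ** (e ** M ** e)"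
  shows "dim_at_most smul (act e ` V) 1"
proof -
  define E where "E = act e ` V"
  have EV: "w \<in> V" and eE: "act e w = w" if "w \<in> E" for w
    using that act_closed act_mult[OF e(1) e(1)] e by (auto simp: E_def)
  have subE: "subspace E"
  proof (rule subspaceI)
    show "0 \<in> E"
      using act_zero_right[OF e(1)] subspace_0[OF carrier_subspace] unfolding E_def by (metis image_eqI)
  qed (use e subspace_add[OF carrier_subspace] subspace_scale[OF carrier_subspace] in
      \<open>auto simp: E_def act_add_right[symmetric] act_scale_right[symmetric]\<close>)
  have corner: "e ** M ** e \<in> T" if "M \<in> T" for M
    using that e T by (simp add: subalgebra_def)
  have act_corner: "act (e ** M ** e) w = act e (act M w)" if "M \<in> T" "w \<in> E" for M w
    using that e T EV eE by (simp add: act_mult subalgebra_def act_closed)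
  have scalar: "\<exists>c. \<forall>w\<in>E. act e (act M w) = smul c w" if M: "M \<in> T" for M
  proof (cases "E = {0}")
    case True
    then show ?thesis using M by (auto simp: act_zero_right e)
  next
    case False
    then obtain v where v: "v \<in> E" "v \<noteq> 0" using subspace_0[OF subE] by blast
    interpret E: linear_on_subspace smul E "act (e ** M ** e)"
    proof
      show "subspace E" by (rule subE)
      show "act (e ** M ** e) w \<in> E" if "w \<in> E" for w
        using that M EV by (auto simp: act_corner E_def act_closed)
      show "act (e ** M ** e) (w + w') = act (e ** M ** e) w + act (e ** M ** e) w'"
        if "w \<in> E" "w' \<in> E" for w w'
        using that corner[OF M] EV by (simp add: act_add_right)
      show "act (e ** M ** e) (smul c w) = smul c (act (e ** M ** e) w)"
        if "w \<in> E" for c w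
        using that corner[OF M] EV by (simp add: act_scale_right)
    qed
    obtain p where p: "p \<noteq> 0" "E.poly_apply p v = 0"
      using annihilating_poly[OF T corner[OF M] E.linear_on_subspace_axioms v(1) EV[OF v(1)]]
      by blast
    have "\<exists>z. poly q z = 0" if "degree q > 0" for q :: "complex poly"
      using that by (intro fundamental_theorem_of_algebra) (simp add: constant_degree)
    then obtain c w where w: "w \<in> E" "w \<noteq> 0" "act (e ** M ** e) w = smul c w"
      using E.eigenvector_exists[OF _ v p] by blast
    have "act e (act M u) = smul c u" if u: "u \<in> E" for u
    proof -
      \<comment> \<open>Since \<open>e\<close> fixes both \<open>u\<close> and \<open>w\<close>, the
        matrix leading from \<open>w\<close> to \<open>u\<close> may be replaced by its corner,
        which commutes with that of \<open>M\<close>.\<close>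
      obtain N where N: "N \<in> T" "u = act N w"
        using cyclic[OF T EV[OF w(1)] w(2) EV[OF u]] by blast
      then have uN: "u = act (e ** N ** e) w" using eE[OF u] w by (simp add: act_corner)
      have "act e (act M u) = act (e ** M ** e) (act (e ** N ** e) w)"
        using act_corner[OF M u] uN by simp
      also have "\<dots> = act (e ** N ** e) (act (e ** M ** e) w)"
        using comm[OF M N(1)] by (metis act_mult corner M N(1) EV w(1))
      also have "\<dots> = smul c u"
        using uN w EV by (simp add: act_scale_right corner N(1))
      finally show ?thesis .
    qed
    then show ?thesis by blast
  qed
  obtain v where v: "E \<subseteq> span {v}"
  proof (cases "E = {0}")
    case True
    then show ?thesis using that by (simp add: span_zero)
  next
    case False
    then obtain v where v: "v \<in> E" "v \<noteq> 0" using subspace_0[OF subE] by blast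
    have "u \<in> span {v}" if u: "u \<in> E" for u
    proof -
      \<comment> \<open>Cyclicity once more: \<open>u\<close> is the image of \<open>v\<close> under
        a corner element, and these act as scalars.\<close>
      obtain N where N: "N \<in> T" "u = act N v"
        using cyclic[OF T EV[OF v(1)] v(2) EV[OF u]] by blast
      then have "u = act e (act N v)" using eE[OF u] by simp
      then show ?thesis using scalar[OF N(1)] v(1) span_scale[OF span_base[of v "{v}"]] by fastforce
    qed
    then show ?thesis using that by blast
  qed
  then have "dim E \<le> 1" using dim_le_card[of E "{v}"] by simp
  then show ?thesis unfolding dim_at_most_def E_def[symmetric] using v by blast
qed

end

subsection \<open>Corners of the Terwilliger algebra\<close>

lemma matrix_add_mult_right:
  fixes M N L :: "complex^'x::finite^'x"
  shows "(M + N) ** L = M ** L + N ** L"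
  by (simp add: vec_eq_iff matrix_matrix_mult_def algebra_simps sum.distrib)

lemma matrix_mult_mat_scale:
  fixes M N :: "complex^'x::finite^'x"
  shows "mat_scale c M ** N = mat_scale c (M ** N)" "M ** mat_scale c N = mat_scale c (M ** N)"
  by (simp_all add: vec_eq_iff matrix_matrix_mult_def mat_scale_def sum_distrib_left mult_ac)

lemma matrix_mult_zero:
  fixes M :: "complex^'x::finite^'x"
  shows "M ** 0 = 0" "0 ** M = 0"
  by (simp_all add: vec_eq_iff matrix_matrix_mult_def)

lemma mat_scale_zero [simp]: "mat_scale 0 M = 0" "mat_scale c 0 = 0"
  by (simp_all add: vec_eq_iff mat_scale_def)

lemma mat_scale_mat_scale: "mat_scale c (mat_scale d M) = mat_scale (c * d) M"
  by (simp add: vec_eq_iff mat_scale_def)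

definition ones :: "complex^'x^'x" where
  "ones = (\<chi> y z. 1)"

text \<open>\<open>ones\<close> has rank one; the scalar is the sum of all entries of
  \<open>M\<close>.\<close>

lemma ones_mult_ones: "\<exists>c. ones ** M ** ones = mat_scale c (ones :: complex^'x::finite^'x)"
  by (rule exI[of _ "\<Sum>i\<in>UNIV. \<Sum>j\<in>UNIV. M $ j $ i"])
     (simp add: vec_eq_iff matrix_matrix_mult_def mat_scale_def ones_def)

lemma subalgebra_terwilliger: "subalgebra (terwilliger_algebra S x)"
  unfolding terwilliger_algebra_def
  by (rule hull_in) (auto simp: subalgebra_def)

lemma matrix_mult_dual_idempotent:
  "(M ** dual_idempotent x s) $ y $ z = (if (x, z) \<in> s then M $ y $ z else 0)"
  "(dual_idempotent x s ** M) $ y $ z = (if (x, y) \<in> s then M $ y $ z else 0)"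
proof -
  have "(M ** dual_idempotent x s) $ y $ z
      = (\<Sum>k\<in>UNIV. if k = z then if (x, z) \<in> s then M $ y $ z else 0 else 0)"
    unfolding matrix_matrix_mult_def dual_idempotent_def vec_lambda_beta
    by (rule sum.cong) auto
  then show "(M ** dual_idempotent x s) $ y $ z = (if (x, z) \<in> s then M $ y $ z else 0)"
    by simp
  have "(dual_idempotent x s ** M) $ y $ z
      = (\<Sum>k\<in>UNIV. if k = y then if (x, y) \<in> s then M $ y $ z else 0 else 0)"
    unfolding matrix_matrix_mult_def dual_idempotent_def vec_lambda_beta
    by (rule sum.cong) auto
  then show "(dual_idempotent x s ** M) $ y $ z = (if (x, y) \<in> s then M $ y $ z else 0)"
    by simp
qed

lemma dual_idempotent_idem:
  "dual_idempotent x s ** dual_idempotent x s = dual_idempotent x s"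
  by (simp add: vec_eq_iff matrix_mult_dual_idempotent) (simp add: dual_idempotent_def)

text \<open>
  The parameters are the valencies and intersection numbers of a rank 3 scheme; only the shape of
  the relations matters below, not the values.
\<close>

locale quadratic_tournament =
  fixes s :: "('x::finite) rel" and x :: 'x and k k' \<alpha> \<beta> \<gamma> :: complex
  assumes tournament: "(y, z) \<in> s \<longleftrightarrow> y \<noteq> z \<and> (z, y) \<notin> s"
    and row_sum: "adjacency s ** ones = mat_scale k ones"
    and col_sum: "ones ** adjacency s = mat_scale k' ones"
    and quadratic: "adjacency s ** adjacency s
      = mat_scale \<alpha> (adjacency s) + mat_scale \<beta> (mat 1) + mat_scale \<gamma> ones"
begin

abbreviation "A \<equiv> adjacency s"
abbreviation "e0 \<equiv> dual_idempotent x Id"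
abbreviation "e1 \<equiv> dual_idempotent x s"
abbreviation "e2 \<equiv> dual_idempotent x (s\<inverse>)"

section \<open>Neighbourhoods of the base point\<close>

lemma tournament_irrefl: "(y, y) \<notin> s"
  and tournament_asym: "(y, z) \<in> s \<Longrightarrow> (z, y) \<notin> s"
  and tournament_total: "(y, z) \<notin> s \<Longrightarrow> y \<noteq> z \<Longrightarrow> (z, y) \<in> s"
  using tournament by blast+

lemma idempotents_sum: "e0 + e1 + e2 = mat 1"
  by (auto simp: vec_eq_iff dual_idempotent_def mat_def tournament_irrefl
      dest: tournament_asym tournament_total)

lemma idempotents_orthogonal:
  "e1 ** e0 = 0" "e2 ** e0 = 0" "e0 ** e1 = 0" "e2 ** e1 = 0" "e0 ** e2 = 0" "e1 ** e2 = 0"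
  by (simp_all add: vec_eq_iff matrix_mult_dual_idempotent)
     (auto simp: dual_idempotent_def tournament_irrefl dest: tournament_asym)

text \<open>No arc leads from an out-neighbour of \<open>x\<close> back to \<open>x\<close>; this
  removes the base point from walks that leave the first neighbourhood.\<close>

lemma adjacency_base_column: "e1 ** A ** e0 = 0"
  by (auto simp: vec_eq_iff matrix_mult_dual_idempotent adjacency_def dest: tournament_asym)

text \<open>Every row of \<open>ones ** e0\<close> is the unit vector at \<open>x\<close>, which
  picks out row \<open>x\<close> of \<open>A\<close>, the indicator of the first
  neighbourhood.\<close>

lemma adjacency_base_row: "ones ** e0 ** A = ones ** e1"
proof -
  have "(ones ** e0 ** A) $ y $ z = (ones ** e1) $ y $ z" for y z
  proof -
    have "(ones ** e0 ** A) $ y $ z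
        = (\<Sum>k\<in>UNIV. if k = x then if (x, z) \<in> s then 1 else 0 else 0)"
      unfolding matrix_matrix_mult_def[of _ A] vec_lambda_beta matrix_mult_dual_idempotent
      by (rule sum.cong) (auto simp: adjacency_def ones_def)
    then show ?thesis by (simp add: matrix_mult_dual_idempotent ones_def)
  qed
  then show ?thesis by (simp add: vec_eq_iff)
qed

lemma ones_base_ones: "ones ** e0 ** ones = ones"
proof -
  have "(ones ** e0 ** ones) $ y $ z = (1::complex)" for y z
  proof -
    have "(ones ** e0 ** ones) $ y $ z = (\<Sum>k\<in>UNIV. if k = x then 1 else 0 :: complex)"
      unfolding matrix_matrix_mult_def[of _ ones] vec_lambda_beta matrix_mult_dual_idempotent
      by (rule sum.cong) (auto simp: ones_def)
    then show ?thesis by simp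
  qed
  then show ?thesis by (simp add: vec_eq_iff ones_def)
qed

section \<open>The commutative algebra of the first neighbourhood\<close>

text \<open>
  Taking the double commutant of \<open>e1\<close>, \<open>e1 A e1\<close> and \<open>e1 J e1\<close> avoids speaking about polynomials
  in these matrices; it is commutative because its generators commute.
\<close>

definition local_algebra :: "(complex^'x^'x) set" where
  "local_algebra = {X. e1 ** X = X \<and> X ** e1 = X \<and>
     (\<forall>Z. Z ** e1 = e1 ** Z \<longrightarrow> Z ** (e1 ** A ** e1) = e1 ** A ** e1 ** Z \<longrightarrow>
       Z ** (e1 ** ones ** e1) = e1 ** ones ** e1 ** Z \<longrightarrow> Z ** X = X ** Z)}"

lemma local_algebraD: "X \<in> local_algebra \<Longrightarrow> e1 ** X = X" "X \<in> local_algebra \<Longrightarrow> X ** e1 = X"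
  by (auto simp: local_algebra_def)

lemma local_algebra_idempotent: "e1 \<in> local_algebra"
  by (simp add: local_algebra_def dual_idempotent_idem)

lemma e1_e1: "M ** e1 ** e1 = M ** e1"
  by (simp add: matrix_mul_assoc[symmetric] dual_idempotent_idem)

lemma local_algebra_adjacency: "e1 ** A ** e1 \<in> local_algebra"
  unfolding local_algebra_def by (simp add: matrix_mul_assoc dual_idempotent_idem e1_e1)

lemma local_algebra_ones: "e1 ** ones ** e1 \<in> local_algebra"
  unfolding local_algebra_def by (simp add: matrix_mul_assoc dual_idempotent_idem e1_e1)

lemma local_algebra_add: "X \<in> local_algebra \<Longrightarrow> Y \<in> local_algebra \<Longrightarrow> X + Y \<in> local_algebra"
  unfolding local_algebra_def by (simp add: matrix_add_ldistrib matrix_add_mult_right)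

lemma local_algebra_scale: "X \<in> local_algebra \<Longrightarrow> mat_scale c X \<in> local_algebra"
  unfolding local_algebra_def by (simp add: matrix_mult_mat_scale)

lemma local_algebra_mult:
  assumes "X \<in> local_algebra" "Y \<in> local_algebra"
  shows "X ** Y \<in> local_algebra"
proof -
  have "e1 ** (X ** Y) = X ** Y" "X ** Y ** e1 = X ** Y"
    using assms
    by (simp_all add: matrix_mul_assoc local_algebraD)
       (simp add: matrix_mul_assoc[symmetric] local_algebraD)
  moreover have "Z ** (X ** Y) = X ** Y ** Z" if "Z ** X = X ** Z" "Z ** Y = Y ** Z" for Z
    using that by (metis matrix_mul_assoc)
  ultimately show ?thesis using assms unfolding local_algebra_def by blast
qed

lemma ones_first_ones:
  "ones ** e1 ** ones = mat_scale (of_nat (card {y. (x, y) \<in> s})) ones"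
proof -
  have "(ones ** e1 ** ones) $ y $ z = (\<Sum>w\<in>UNIV. if (x, w) \<in> s then 1 else 0 :: complex)"
    for y z
    unfolding matrix_matrix_mult_def[of _ ones] vec_lambda_beta matrix_mult_dual_idempotent
    by (rule sum.cong) (auto simp: ones_def)
  then show ?thesis by (simp add: vec_eq_iff mat_scale_def ones_def sum.If_cases)
qed

text \<open>The scalar is the number of out-neighbours of \<open>x\<close>. Later arguments divide
  by it, so an empty neighbourhood is split off.\<close>

lemma first_idempotent_cases:
  obtains "e1 = 0" | c where "c \<noteq> 0" "ones ** e1 ** ones = mat_scale c ones"
proof (cases "{y. (x, y) \<in> s} = {}")
  case True
  then have "e1 = 0" by (auto simp: vec_eq_iff dual_idempotent_def)
  then show ?thesis by (rule that(1))
next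
  case False
  then have "complex_of_nat (card {y. (x, y) \<in> s}) \<noteq> 0" by simp
  then show ?thesis using that(2) ones_first_ones by blast
qed

text \<open>The indicator of the first neighbourhood is itself a row of \<open>A\<close>, so a step
  from there is a two-step walk from \<open>x\<close>, which \<open>quadratic\<close>
  evaluates.\<close>

lemma ones_first_adjacency:
  "ones ** e1 ** A = mat_scale \<alpha> (ones ** e1) + mat_scale \<beta> (ones ** e0) + mat_scale \<gamma> ones"
proof -
  have "ones ** e1 ** A = ones ** e0 ** (A ** A)"
    by (simp add: matrix_mul_assoc adjacency_base_row)
  then show ?thesis
    by (simp add: quadratic matrix_add_ldistrib matrix_mult_mat_scale adjacency_base_row
        ones_base_ones)
qed

lemma transpose_dual_idempotent: "transpose (dual_idempotent x t) = dual_idempotent x t"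
  by (auto simp: vec_eq_iff transpose_def dual_idempotent_def)

lemma adjacency_transpose: "A + transpose A + mat 1 = ones"
  by (auto simp: vec_eq_iff transpose_def adjacency_def mat_def ones_def tournament_irrefl
      dest: tournament_asym tournament_total)

text \<open>
  Left multiplication is controlled by the quadratic relation; right multiplication follows by
  transposing, since \<open>B + B\<^sup>T + e1 = L\<close>.
\<close>

lemma local_generators_commute:
  "e1 ** A ** e1 ** (e1 ** ones ** e1) = e1 ** ones ** e1 ** (e1 ** A ** e1)"
proof (cases rule: first_idempotent_cases)
  case 1
  then show ?thesis by (simp add: matrix_mult_zero)
next
  case (2 c)
  define B L where "B = e1 ** A ** e1" and "L = e1 ** ones ** e1"
  have LB: "L ** B = mat_scale (\<alpha> + \<gamma>) L"
  proof -
    have e0_e1: "N ** e0 ** e1 = 0" for N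
      by (simp add: matrix_mul_assoc[symmetric] idempotents_orthogonal matrix_mult_zero)
    have "L ** B = e1 ** (ones ** e1 ** A) ** e1"
      by (simp add: L_def B_def matrix_mul_assoc e1_e1)
    also have "\<dots> = mat_scale \<alpha> L + mat_scale \<gamma> L"
      unfolding ones_first_adjacency
      by (simp add: L_def matrix_mul_assoc matrix_add_ldistrib matrix_add_mult_right
          matrix_mult_mat_scale e1_e1 e0_e1)
    finally show ?thesis by (simp add: vec_eq_iff mat_scale_def algebra_simps)
  qed
  have LL: "L ** L = mat_scale c L"
  proof -
    have "L ** L = e1 ** (ones ** e1 ** ones) ** e1"
      by (simp add: L_def matrix_mul_assoc e1_e1)
    then show ?thesis by (simp add: 2 L_def matrix_mult_mat_scale)
  qed
  have tL: "transpose L = L"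
  proof -
    have "transpose (ones :: complex^'x^'x) = ones"
      by (simp add: vec_eq_iff transpose_def ones_def)
    then show ?thesis
      by (simp add: L_def matrix_transpose_mul transpose_dual_idempotent matrix_mul_assoc)
  qed
  have "transpose (L ** B) = mat_scale (\<alpha> + \<gamma>) (transpose L)"
    unfolding LB by (simp add: vec_eq_iff transpose_def mat_scale_def)
  then have tBL: "transpose B ** L = mat_scale (\<alpha> + \<gamma>) L"
    by (simp add: matrix_transpose_mul tL)
  have "B + transpose B + e1 = e1 ** (A + transpose A + mat 1) ** e1"
    by (simp add: B_def matrix_transpose_mul transpose_dual_idempotent matrix_add_ldistrib
        matrix_add_mult_right matrix_mul_assoc dual_idempotent_idem)
  then have "B + transpose B + e1 = L"
    by (simp add: adjacency_transpose L_def)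
  then have "B ** L + transpose B ** L + e1 ** L = L ** L"
    by (metis matrix_add_mult_right)
  moreover have "e1 ** L = L" by (simp add: L_def matrix_mul_assoc dual_idempotent_idem)
  ultimately have "B ** L + mat_scale (\<alpha> + \<gamma>) L + L = mat_scale c L"
    by (simp add: tBL LL)
  then have "B ** L = mat_scale c L - L - mat_scale (\<alpha> + \<gamma>) L"
    by (metis add_diff_cancel_right')
  also have "\<dots> = mat_scale (c - 1 - (\<alpha> + \<gamma>)) L"
    by (simp add: vec_eq_iff mat_scale_def left_diff_distrib)
  finally obtain d where BL: "B ** L = mat_scale d L" by blast
  \<comment> \<open>Both \<open>L ** B\<close> and \<open>B ** L\<close> are multiples of
    \<open>L\<close>; evaluating L B L in two ways, with \<open>c\<close> nonzero, shows that the
    scalars act alike on \<open>L\<close>.\<close>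
  have "L ** (B ** L) = L ** B ** L" by (simp add: matrix_mul_assoc)
  then have "mat_scale (d * c) L = mat_scale ((\<alpha> + \<gamma>) * c) L"
    by (simp add: BL LB matrix_mult_mat_scale LL mat_scale_mat_scale)
  then have "B ** L = L ** B"
    using \<open>c \<noteq> 0\<close> by (simp add: BL LB vec_eq_iff mat_scale_def)
  then show ?thesis by (simp add: B_def L_def)
qed

text \<open>The generators commute with one another, so each of them is an admissible
  \<open>Z\<close> in the definition of the double commutant.\<close>

lemma local_algebra_commute_generators:
  assumes "X \<in> local_algebra"
  shows "X ** (e1 ** A ** e1) = e1 ** A ** e1 ** X"
    and "X ** (e1 ** ones ** e1) = e1 ** ones ** e1 ** X"
proof -
  have Z: "Z ** X = X ** Z"
    if "Z ** e1 = e1 ** Z" "Z ** (e1 ** A ** e1) = e1 ** A ** e1 ** Z"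
      "Z ** (e1 ** ones ** e1) = e1 ** ones ** e1 ** Z" for Z
    using assms that by (simp add: local_algebra_def)
  show "X ** (e1 ** A ** e1) = e1 ** A ** e1 ** X"
    by (rule Z[symmetric])
       (simp_all add: local_generators_commute local_algebraD[OF local_algebra_adjacency])
  show "X ** (e1 ** ones ** e1) = e1 ** ones ** e1 ** X"
    by (rule Z[symmetric])
       (simp_all add: local_generators_commute local_algebraD[OF local_algebra_ones])
qed

text \<open>By the preceding lemma \<open>X\<close> commutes with the generators, hence is an
  admissible \<open>Z\<close> for \<open>Y\<close>.\<close>

lemma local_algebra_commute:
  assumes X: "X \<in> local_algebra" and Y: "Y \<in> local_algebra"
  shows "X ** Y = Y ** X"
  using Y local_algebra_commute_generators[OF X] local_algebraD[OF X]
  by (simp add: local_algebra_def)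

text \<open>\<open>X\<close> has constant row sums on the first neighbourhood because it commutes
  with \<open>e1 ** ones ** e1\<close>: inserting \<open>ones ** e1 ** ones\<close> lets
  \<open>X\<close> move between two factors \<open>ones\<close>, where it becomes a scalar.\<close>

lemma local_algebra_ones_right:
  assumes X: "X \<in> local_algebra"
  shows "\<exists>c. X ** ones = mat_scale c (e1 ** ones)"
proof (cases rule: first_idempotent_cases)
  case 1
  then have "X = 0" using local_algebraD(2)[OF X] by (simp add: matrix_mult_zero)
  then show ?thesis by (intro exI[of _ 0]) (simp add: matrix_mult_zero)
next
  case (2 c)
  obtain d where d: "ones ** X ** ones = mat_scale d ones"
    using ones_mult_ones by blast
  have "mat_scale c (X ** ones) = X ** (ones ** e1 ** ones)"
    by (simp add: 2 matrix_mult_mat_scale)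
  also have "\<dots> = X ** (e1 ** ones ** e1) ** ones"
    by (simp add: matrix_mul_assoc local_algebraD[OF X])
  also have "\<dots> = e1 ** (ones ** (e1 ** X) ** ones)"
    unfolding local_algebra_commute_generators[OF X] by (simp add: matrix_mul_assoc)
  also have "\<dots> = mat_scale d (e1 ** ones)"
    by (simp add: local_algebraD[OF X] d matrix_mult_mat_scale)
  finally have "mat_scale (inverse c) (mat_scale c (X ** ones))
      = mat_scale (inverse c) (mat_scale d (e1 ** ones))" by simp
  then have "X ** ones = mat_scale (inverse c * d) (e1 ** ones)"
    using \<open>c \<noteq> 0\<close> by (simp add: mat_scale_mat_scale) (simp add: vec_eq_iff mat_scale_def)
  then show ?thesis by blast
qed

section \<open>Matrices with rows in the first neighbourhood\<close>

text \<open>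
  This space contains \<open>e1\<close> and is stable under right multiplication by \<open>T\<close>, so it contains \<open>e1 T\<close>.
\<close>

inductive_set first_rows :: "(complex^'x^'x) set" where
  local: "X \<in> local_algebra \<Longrightarrow> X \<in> first_rows"
| cross: "X \<in> local_algebra \<Longrightarrow> X ** A ** e2 \<in> first_rows"
| base: "e1 ** ones ** e0 \<in> first_rows"
| last: "e1 ** ones ** e2 \<in> first_rows"
| add: "M \<in> first_rows \<Longrightarrow> N \<in> first_rows \<Longrightarrow> M + N \<in> first_rows"
| scale: "M \<in> first_rows \<Longrightarrow> mat_scale c M \<in> first_rows"

lemma first_rows_zero: "0 \<in> first_rows"
  using first_rows.scale[OF first_rows.base, of 0] by simp

lemma first_rows_diff: "M \<in> first_rows \<Longrightarrow> N \<in> first_rows \<Longrightarrow> M - N \<in> first_rows"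
  using first_rows.add[OF _ first_rows.scale[of N "-1"], of M]
  by (simp add: mat_scale_def vec_eq_iff minus_vec_def plus_vec_def)

lemma split_idempotents: "M ** e0 + M ** e1 + M ** e2 = M"
  by (simp add: matrix_add_ldistrib[symmetric] idempotents_sum)

lemma split_middle: "M ** e0 ** N + M ** e1 ** N + M ** e2 ** N = M ** N"
  for M N :: "complex^'x^'x"
  by (simp add: matrix_add_mult_right[symmetric] split_idempotents)

lemma first_rows_ones: "e1 ** ones \<in> first_rows"
  using split_idempotents[of "e1 ** ones"]
    first_rows.add[OF first_rows.add[OF first_rows.base first_rows.local[OF local_algebra_ones]]
      first_rows.last]
  by simp

lemma local_ones_in_first_rows: "X \<in> local_algebra \<Longrightarrow> X ** ones \<in> first_rows"
  using local_algebra_ones_right[of X] first_rows.scale[OF first_rows_ones] by auto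

text \<open>Sort the columns by neighbourhood: the part at \<open>x\<close> vanishes, the part in
  the first neighbourhood stays local, and the last part is the rule \<open>cross\<close>.\<close>

lemma local_adjacency_in_first_rows:
  assumes X: "X \<in> local_algebra" shows "X ** A \<in> first_rows"
proof -
  have "X ** A ** e0 = X ** (e1 ** A ** e0)"
    by (simp add: matrix_mul_assoc local_algebraD[OF X])
  moreover have "X ** A ** e1 = X ** (e1 ** A ** e1)"
    by (simp add: matrix_mul_assoc local_algebraD[OF X])
  ultimately have "X ** A = X ** (e1 ** A ** e1) + X ** A ** e2"
    using split_idempotents[of "X ** A"]
    by (simp add: adjacency_base_column matrix_mult_zero)
  then show ?thesis
    using first_rows.add[OF first_rows.local[OF local_algebra_mult[OF X local_algebra_adjacency]]
      first_rows.cross[OF X]] by simp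
qed

text \<open>A passage through the second neighbourhood is an unrestricted passage minus one through
  the first, the one through \<open>x\<close> being zero. The unrestricted passage is evaluated by
  \<open>quadratic\<close> or \<open>row_sum\<close>; the one through the first neighbourhood starts
  with the local matrix \<open>X ** (e1 ** A ** e1)\<close>.\<close>

lemma cross_adjacency:
  assumes X: "X \<in> local_algebra"
  shows "X ** A ** e2 ** A \<in> first_rows" "X ** A ** e2 ** ones \<in> first_rows"
proof -
  have XB: "X ** A ** e1 = X ** (e1 ** A ** e1)"
    by (simp add: matrix_mul_assoc local_algebraD[OF X])
  have *: "X ** A ** e2 ** N = X ** A ** N - X ** A ** e1 ** N"
    for N :: "complex^'x^'x"
  proof -
    have "X ** A ** e0 = X ** (e1 ** A ** e0)"
      by (simp add: matrix_mul_assoc local_algebraD[OF X])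
    then have "X ** A ** e0 ** N = 0"
      by (simp add: adjacency_base_column matrix_mult_zero)
    then show ?thesis
      using split_middle[of "X ** A" N] by (simp add: eq_diff_eq add.commute)
  qed
  have XBl: "X ** (e1 ** A ** e1) \<in> local_algebra"
    by (rule local_algebra_mult[OF X local_algebra_adjacency])
  have "X ** A ** A = mat_scale \<alpha> (X ** A) + mat_scale \<beta> X + mat_scale \<gamma> (X ** ones)"
    by (simp add: matrix_mul_assoc[symmetric] quadratic)
       (simp add: matrix_add_ldistrib matrix_mult_mat_scale)
  then have "X ** A ** A \<in> first_rows"
    by (simp add: X first_rows.add first_rows.scale local_adjacency_in_first_rows
        local_ones_in_first_rows first_rows.local)
  then show "X ** A ** e2 ** A \<in> first_rows"
    unfolding * XB by (rule first_rows_diff[OF _ local_adjacency_in_first_rows[OF XBl]])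
  have "X ** A ** ones = mat_scale k (X ** ones)"
    by (simp add: matrix_mul_assoc[symmetric] row_sum matrix_mult_mat_scale)
  then have "X ** A ** ones \<in> first_rows"
    using local_ones_in_first_rows[OF X] first_rows.scale by simp
  then show "X ** A ** e2 ** ones \<in> first_rows"
    unfolding * XB by (rule first_rows_diff[OF _ local_ones_in_first_rows[OF XBl]])
qed

lemma first_rows_mult_adjacency: "M \<in> first_rows \<Longrightarrow> M ** A \<in> first_rows"
proof (induction rule: first_rows.induct)
  case base
  have "e1 ** ones ** e0 ** A = e1 ** (ones ** e0 ** A)" by (simp add: matrix_mul_assoc)
  then have "e1 ** ones ** e0 ** A = e1 ** ones ** e1"
    by (simp add: adjacency_base_row matrix_mul_assoc)
  then show ?case by (simp add: first_rows.local local_algebra_ones)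
next
  case last
  have 0: "e1 ** ones ** e0 ** A = e1 ** ones ** e1"
    by (metis adjacency_base_row matrix_mul_assoc)
  have "e1 ** ones ** e1 ** A = e1 ** (ones ** e1 ** A)" by (simp add: matrix_mul_assoc)
  also have "\<dots> = mat_scale \<alpha> (e1 ** ones ** e1) + mat_scale \<beta> (e1 ** ones ** e0)
      + mat_scale \<gamma> (e1 ** ones)"
    unfolding ones_first_adjacency
    by (simp add: matrix_add_ldistrib matrix_mult_mat_scale matrix_mul_assoc)
  finally have 1: "e1 ** ones ** e1 ** A \<in> first_rows"
    by (simp add: first_rows.add first_rows.scale first_rows.local local_algebra_ones
        first_rows.base first_rows_ones)
  \<comment> \<open>The block through \<open>e2\<close> is again a complement: constant column sums
    give the total, and the blocks through \<open>e0\<close> and \<open>e1\<close> are already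
    known.\<close>
  have "e1 ** ones ** A = mat_scale k' (e1 ** ones)"
    by (simp add: matrix_mul_assoc[symmetric] col_sum matrix_mult_mat_scale)
  then have "e1 ** ones ** e2 ** A
      = mat_scale k' (e1 ** ones) - e1 ** ones ** e0 ** A - e1 ** ones ** e1 ** A"
    using split_middle[of "e1 ** ones" A] by (simp add: algebra_simps)
  then show ?case
    using 1 by (simp add: 0 first_rows_diff first_rows.scale first_rows_ones
        first_rows.local[OF local_algebra_ones])
qed (auto simp: matrix_add_mult_right matrix_mult_mat_scale cross_adjacency
    local_adjacency_in_first_rows intro: first_rows.intros)

lemma first_rows_mult_ones: "M \<in> first_rows \<Longrightarrow> M ** ones \<in> first_rows"
proof (induction rule: first_rows.induct)
  case base
  have "e1 ** ones ** e0 ** ones = e1 ** ones"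
    by (metis ones_base_ones matrix_mul_assoc)
  then show ?case by (simp add: first_rows_ones)
next
  case last
  obtain c where "ones ** e2 ** ones = mat_scale c ones" using ones_mult_ones by blast
  then have "e1 ** ones ** e2 ** ones = mat_scale c (e1 ** ones)"
    by (metis matrix_mul_assoc matrix_mult_mat_scale(2))
  then show ?case by (simp add: first_rows.scale first_rows_ones)
qed (auto simp: matrix_add_mult_right matrix_mult_mat_scale cross_adjacency
    local_ones_in_first_rows intro: first_rows.intros)

text \<open>All spanning elements other than the local ones end in \<open>e0\<close> or
  \<open>e2\<close>, so \<open>e1\<close> kills them. Hence the middle claim can land in
  \<open>local_algebra\<close>, as the corner result requires.\<close>

lemma first_rows_mult_idempotent:
  assumes "M \<in> first_rows"
  shows "M ** e0 \<in> first_rows" "M ** e1 \<in> local_algebra" "M ** e2 \<in> first_rows"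
proof -
  have zero: "0 \<in> local_algebra"
    using local_algebra_scale[OF local_algebra_idempotent, of 0] by simp
  have X: "X ** t = X ** (e1 ** t)" if "X \<in> local_algebra" for X t
    using that by (simp add: matrix_mul_assoc local_algebraD)
  have a: "M ** t ** u = M ** (t ** u)" for M t u :: "complex^'x^'x"
    by (simp add: matrix_mul_assoc)
  show "M ** e0 \<in> first_rows"
    using assms
    by induction (auto simp: matrix_add_mult_right matrix_mult_mat_scale a X[of _ e0]
        idempotents_orthogonal dual_idempotent_idem matrix_mult_zero first_rows_zero
        intro: first_rows.add first_rows.scale first_rows.base[unfolded a])
  show "M ** e1 \<in> local_algebra"
    using assms
    by induction (auto simp: matrix_add_mult_right matrix_mult_mat_scale a local_algebraD
        idempotents_orthogonal dual_idempotent_idem matrix_mult_zero zero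
        intro: local_algebra_add local_algebra_scale)
  show "M ** e2 \<in> first_rows"
    using assms
    by induction (auto simp: matrix_add_mult_right matrix_mult_mat_scale a X[of _ e2]
        idempotents_orthogonal dual_idempotent_idem matrix_mult_zero first_rows_zero
        intro: first_rows.add first_rows.scale first_rows.last[unfolded a]
          first_rows.cross[unfolded a])
qed

text \<open>The matrices that preserve \<open>first_rows\<close> from the right form a subalgebra
  containing the generators, hence the whole Terwilliger algebra; apply this to
  \<open>e1\<close>.\<close>

lemma corner_in_local_algebra:
  assumes "M \<in> terwilliger_algebra {Id, s, s\<inverse>} x"
  shows "e1 ** M ** e1 \<in> local_algebra"
proof -
  define U where "U = {M. \<forall>N\<in>first_rows. N ** M \<in> first_rows}"
  have "subalgebra U"
    unfolding subalgebra_def U_def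
    by (auto simp: matrix_add_ldistrib matrix_mult_mat_scale matrix_mul_assoc
        intro: first_rows.add first_rows.scale)
  moreover have "adjacency Id \<in> U"
  proof -
    have "adjacency Id = (mat 1 :: complex^'x^'x)"
      by (simp add: vec_eq_iff adjacency_def mat_def)
    then show ?thesis by (simp add: U_def)
  qed
  moreover have "adjacency (s\<inverse>) \<in> U"
  proof -
    have "adjacency (s\<inverse>) = ones - mat 1 - A"
      by (auto simp: vec_eq_iff adjacency_def mat_def ones_def tournament_irrefl
          dest: tournament_asym tournament_total)
    then have "N ** adjacency (s\<inverse>) = N ** ones - N - N ** A" for N :: "complex^'x^'x"
      by (metis (no_types, lifting) diff_add_cancel eq_diff_eq matrix_add_ldistrib matrix_mul_rid)
    then show ?thesis
      by (simp add: U_def first_rows_diff first_rows_mult_ones first_rows_mult_adjacency)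
  qed
  ultimately have "terwilliger_algebra {Id, s, s\<inverse>} x \<subseteq> U"
    unfolding terwilliger_algebra_def
    by (intro hull_minimal)
       (auto simp: U_def first_rows_mult_adjacency first_rows_mult_idempotent first_rows.local)
  then have "e1 ** M \<in> first_rows"
    using assms first_rows.local[OF local_algebra_idempotent] by (auto simp: U_def)
  then show ?thesis by (rule first_rows_mult_idempotent)
qed

end

section \<open>From the scheme to the quadratic relation, and conclusion\<close>

lemma relation_product_entry:
  "(adjacency p ** adjacency q) $ y $ z = of_nat (card {w. (y, w) \<in> p \<and> (w, z) \<in> q})"
proof -
  have "(adjacency p ** adjacency q) $ y $ z
      = (\<Sum>w\<in>UNIV. if (y, w) \<in> p \<and> (w, z) \<in> q then 1 else 0)"
    unfolding matrix_matrix_mult_def adjacency_def vec_lambda_beta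
    by (rule sum.cong) auto
  then show ?thesis by (simp add: sum.If_cases)
qed

lemma adjacency_ones_entry:
  "(adjacency s ** ones) $ y $ z = of_nat (card {w. (y, w) \<in> s})"
  "(ones ** adjacency s) $ y $ z = of_nat (card {w. (w, z) \<in> s})"
  by (simp_all add: matrix_matrix_mult_def adjacency_def ones_def if_distrib if_distribR
      sum.If_cases)

text \<open>\<open>Id\<close> is symmetric, so a nonsymmetric \<open>s\<close>, its converse and
  \<open>Id\<close> are three distinct relations and exhaust the rank.\<close>

lemma asymmetric_scheme_rank_3:
  assumes "association_scheme S" "scheme_rank S = 3" "asymmetric S"
  obtains s where "S = {Id, s, s\<inverse>}" "s\<inverse> \<noteq> s"
proof -
  obtain s where s: "s \<in> S" "s\<inverse> \<noteq> s" using assms(3) by (auto simp: asymmetric_def)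
  have sub: "{Id, s, s\<inverse>} \<subseteq> S" using assms(1) s by (auto simp: association_scheme_def)
  have "s \<noteq> Id" "s\<inverse> \<noteq> Id" using s by auto
  then have "card {Id, s, s\<inverse>} = card S"
    using s assms(2) by (auto simp: scheme_rank_def)
  moreover have "finite S" using assms(2) by (auto simp: scheme_rank_def intro: card_ge_0_finite)
  ultimately have "{Id, s, s\<inverse>} = S" using sub card_subset_eq by blast
  then show ?thesis using that s by blast
qed

lemma quadratic_tournament_of_scheme:
  assumes scheme: "association_scheme S" and S: "S = {Id, s, s\<inverse>}" and asym: "s\<inverse> \<noteq> s"
  shows "\<exists>k k' \<alpha> \<beta> \<gamma>. quadratic_tournament s k k' \<alpha> \<beta> \<gamma>"
proof -
  have part: "partition_on UNIV S"
    and reg: "\<And>p q r. p \<in> S \<Longrightarrow> q \<in> S \<Longrightarrow> r \<in> S \<Longrightarrow>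
      \<exists>c. \<forall>(a, b)\<in>r. card {z. (a, z) \<in> p \<and> (z, b) \<in> q} = c"
    using scheme by (auto simp: association_scheme_def)
  have disj: "p \<inter> q = {}" if "p \<in> S" "q \<in> S" "p \<noteq> q" for p q
    using partition_onD2[OF part] that by (auto simp: disjoint_def)
  have cover: "Id \<union> s \<union> s\<inverse> = UNIV" using partition_onD1[OF part] S by auto
  have "s \<noteq> Id" "s\<inverse> \<noteq> Id" using asym by auto
  then have "Id \<inter> s = {}" "s \<inter> s\<inverse> = {}" using disj[of Id s] disj[of s "s\<inverse>"] asym S
    by auto
  then have irrefl: "(y, y) \<notin> s" and asymp: "(y, z) \<in> s \<Longrightarrow> (z, y) \<notin> s" for y z
    by auto
  have total: "y = z \<or> (y, z) \<in> s \<or> (z, y) \<in> s" for y z using cover by auto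
  \<comment> \<open>Valencies are intersection numbers at \<open>Id\<close>: walks out along
    \<open>s\<close> and straight back count the out-neighbours.\<close>
  obtain k where "\<forall>(y, z)\<in>Id. card {w. (y, w) \<in> s \<and> (w, z) \<in> s\<inverse>} = k"
    using reg[of s "s\<inverse>" Id] S by blast
  then have k: "card {w. (y, w) \<in> s} = k" for y by (auto dest: bspec[of _ _ "(y, y)"])
  obtain k' where "\<forall>(y, z)\<in>Id. card {w. (y, w) \<in> s\<inverse> \<and> (w, z) \<in> s} = k'"
    using reg[of "s\<inverse>" s Id] S by blast
  then have k': "card {w. (w, y) \<in> s} = k'" for y by (auto dest: bspec[of _ _ "(y, y)"])
  obtain c0 where "\<forall>(y, z)\<in>Id. card {w. (y, w) \<in> s \<and> (w, z) \<in> s} = c0"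
    using reg[of s s Id] S by blast
  then have c0: "card {w. (y, w) \<in> s \<and> (w, y) \<in> s} = c0" for y
    by (auto dest: bspec[of _ _ "(y, y)"])
  obtain c1 where "\<forall>(y, z)\<in>s. card {w. (y, w) \<in> s \<and> (w, z) \<in> s} = c1"
    using reg[of s s s] S by blast
  then have c1: "(y, z) \<in> s \<Longrightarrow> card {w. (y, w) \<in> s \<and> (w, z) \<in> s} = c1" for y z
    by (auto dest: bspec[of _ _ "(y, z)"])
  obtain c2 where "\<forall>(y, z)\<in>s\<inverse>. card {w. (y, w) \<in> s \<and> (w, z) \<in> s} = c2"
    using reg[of s s "s\<inverse>"] S by blast
  then have c2: "(z, y) \<in> s \<Longrightarrow> card {w. (y, w) \<in> s \<and> (w, z) \<in> s} = c2" for y z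
    by (auto dest: bspec[of _ _ "(y, z)"])
  \<comment> \<open>The square of A is c0 I + c1 A + c2 (J - I - A), because J - I - A is the
    transpose of A; collecting terms gives the coefficients.\<close>
  have "quadratic_tournament s (of_nat k) (of_nat k') (of_nat c1 - of_nat c2)
      (of_nat c0 - of_nat c2) (of_nat c2)"
  proof
    show "(y, z) \<in> s \<longleftrightarrow> y \<noteq> z \<and> (z, y) \<notin> s" for y z
      using irrefl asymp[of y z] total[of y z] by auto
    show "adjacency s ** ones = mat_scale (of_nat k) ones"
      "ones ** adjacency s = mat_scale (of_nat k') ones"
      by (simp_all add: vec_eq_iff adjacency_ones_entry k k' mat_scale_def)
         (simp_all add: ones_def)
    have "(adjacency s ** adjacency s) $ y $ z
        = (mat_scale (of_nat c1 - of_nat c2) (adjacency s)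
          + mat_scale (of_nat c0 - of_nat c2) (mat 1) + mat_scale (of_nat c2) ones) $ y $ z" for y z
      using total[of y z] irrefl[of y] asymp[of y z] asymp[of z y]
        c0[of y] c1[of y z] c2[of z y]
      unfolding relation_product_entry
      by (auto simp: mat_scale_def adjacency_def mat_def ones_def)
    then show "adjacency s ** adjacency s = mat_scale (of_nat c1 - of_nat c2) (adjacency s)
        + mat_scale (of_nat c0 - of_nat c2) (mat 1) + mat_scale (of_nat c2) ones"
      by (simp add: vec_eq_iff)
  qed
  then show ?thesis by blast
qed

text \<open>\<open>dual_idempotent x Id\<close> is the matrix unit at (x, x), so its corner consists
  of its multiples.\<close>

lemma base_corner: "dual_idempotent x Id ** M ** dual_idempotent x Id
    = mat_scale (M $ x $ x) (dual_idempotent x Id)"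
  by (auto simp: vec_eq_iff matrix_mult_dual_idempotent mat_scale_def)
     (auto simp: dual_idempotent_def)

lemma corner_commute:
  assumes scheme: "association_scheme S" "scheme_rank S = 3" "asymmetric S" and t: "t \<in> S"
    and MN: "M \<in> terwilliger_algebra S x" "N \<in> terwilliger_algebra S x"
  defines "e \<equiv> dual_idempotent x t"
  shows "(e ** M ** e) ** (e ** N ** e) = (e ** N ** e) ** (e ** M ** e)"
proof -
  obtain s where s: "S = {Id, s, s\<inverse>}" "s\<inverse> \<noteq> s"
    using asymmetric_scheme_rank_3[OF scheme] .
  show ?thesis
  proof (cases "t = Id")
    case True
    then show ?thesis
      by (simp add: e_def base_corner matrix_mult_mat_scale mat_scale_mat_scale mult.commute)
  next
    case False
    \<comment> \<open>Exchanging \<open>s\<close> with its converse turns the second neighbourhood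
      into the first, so both remaining corners are instances of the result for
      \<open>e1\<close>.\<close>
    then consider "t = s" | "t = s\<inverse>" using s(1) t by blast
    then have S: "S = {Id, t, t\<inverse>}" and "t\<inverse> \<noteq> t"
      using s by (metis converse_converse insert_commute)+
    from quadratic_tournament_of_scheme[OF scheme(1) this]
    obtain k k' \<alpha> \<beta> \<gamma> where "quadratic_tournament t k k' \<alpha> \<beta> \<gamma>"
      by blast
    then interpret quadratic_tournament t x k k' \<alpha> \<beta> \<gamma> .
    show ?thesis unfolding e_def
      by (rule local_algebra_commute; rule corner_in_local_algebra) (use MN S in simp_all)
  qed
qed

theorem theorem4p2:
  fixes S :: "('x::finite) rel set" and x :: 'x
    and smul :: "complex \<Rightarrow> 'v::ab_group_add \<Rightarrow> 'v"
    and act :: "complex^'x^'x \<Rightarrow> 'v \<Rightarrow> 'v" and V :: "'v set"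
  assumes "association_scheme S" and "scheme_rank S = 3" and "asymmetric S"
    and "irreducible_module smul (terwilliger_algebra S x) act V"
  shows "\<forall>s\<in>S. dim_at_most smul (act (dual_idempotent x s) ` V) 1"
proof
  fix s assume s: "s \<in> S"
  interpret irreducible_module smul "terwilliger_algebra S x" act V by (rule assms(4))
  have "dual_idempotent x s \<in> terwilliger_algebra S x"
    unfolding terwilliger_algebra_def using s by (intro hull_inc) simp
  then show "dim_at_most smul (act (dual_idempotent x s) ` V) 1"
    by (rule dim_corner_le_1[OF subalgebra_terwilliger _ dual_idempotent_idem])
       (rule corner_commute[OF assms(1-3) s])
qed

end
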